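(* Let $S$ be a finite set of positive integers. Then $p_S(i)=0$ for all $i\in S$, where $p_S$ is the peak polynomial of $S$.
   Context: For a permutation $\pi=\pi_1\cdots\pi_n\in\mathfrak S_n$, an index $1<i<n$ is a peak if $\pi_{i-1}<\pi_i>\pi_{i+1}$; $P(\pi)$ is the set of peaks of $\pi$, and $\mathcal P_S(n)=\{\pi\in\mathfrak S_n: P(\pi)=S\}$. A finite set $S$ of positive integers is admissible if $\mathcal P_S(n)\neq\emptyset$ for some $n$; equivalently $1\notin S$ and $S$ contains no two consecutive integers. Known fact (Billey–Burdzy–Sagan): for a nonempty admissible $S$ with $m=\max(S)$ there is a unique polynomial $p_S(x)$, of degree $m-1$ and integer-valued on integers, such that $|\mathcal P_S(n)|=p_S(n)2^{n-|S|-1}$ for all $n\ge m$; for $S=\emptyset$, $|\mathcal P_\emptyset(n)|=2^{n-1}$ and $p_\emptyset(x)=1$. If $S$ is not admissible, $p_S(x)=0$ (the zero polynomial). $p_S$ is called the peak polynomial of $S$. *)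

theory Defs
  imports "HOL-Combinatorics.Permutations" "HOL-Computational_Algebra.Polynomial"
begin

text \<open>
  A permutation of \<open>{1..n}\<close> is a function \<open>\<pi>\<close> with \<open>\<pi> permutes {1..n}\<close>;
  its one-line notation is \<open>\<pi> 1, \<dots>, \<pi> n\<close>.
\<close>

definition peaks :: "nat \<Rightarrow> (nat \<Rightarrow> nat) \<Rightarrow> nat set" where
  "peaks n \<pi> = {i. 1 < i \<and> i < n \<and> \<pi> (i - 1) < \<pi> i \<and> \<pi> i > \<pi> (i + 1)}"

definition perms_with_peaks :: "nat set \<Rightarrow> nat \<Rightarrow> (nat \<Rightarrow> nat) set" where
  "perms_with_peaks S n = {\<pi>. \<pi> permutes {1..n} \<and> peaks n \<pi> = S}"

definition admissible :: "nat set \<Rightarrow> bool" where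
  "admissible S \<longleftrightarrow> (\<exists>n. perms_with_peaks S n \<noteq> {})"

text \<open>
  For a nonempty admissible \<open>S\<close> we have \<open>Max S \<ge> 2\<close> and \<open>2 * card S \<le> Max S\<close>, so for
  \<open>n \<ge> Max S\<close> the subtraction in the exponent does not truncate.
\<close>

definition counts_peaks :: "nat set \<Rightarrow> rat poly \<Rightarrow> bool" where
  "counts_peaks S p \<longleftrightarrow>
     (\<forall>n \<ge> Max S. of_nat (card (perms_with_peaks S n)) = poly p (of_nat n) * 2 ^ (n - card S - 1))"

lemma counts_peaks_unique:
  assumes "counts_peaks S p" "counts_peaks S q"
  shows "p = q"
proof (rule ccontr)
  assume "p \<noteq> q"
  then have "finite {x. poly (p - q) x = 0}"
    by (intro poly_roots_finite) simp
  moreover have "of_nat ` {Max S..} \<subseteq> {x. poly (p - q) x = 0}"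
    using assms by (auto simp: counts_peaks_def)
  ultimately have "finite (of_nat ` {Max S..} :: rat set)"
    by (rule rev_finite_subset)
  then show False
    by (auto dest!: finite_imageD simp: infinite_Ici)
qed

text \<open>
  The theorem of Billey, Burdzy and Sagan states that for a nonempty admissible \<open>S\<close> some
  polynomial satisfies \<^const>\<open>counts_peaks\<close>; it is unique by the lemma above, so its degree
  \<open>Max S - 1\<close> and its integrality on the integers are consequences and need not be imposed here.
\<close>

definition peak_poly :: "nat set \<Rightarrow> rat poly" where
  "peak_poly S =
     (if \<not> admissible S then 0
      else if S = {} then 1
      else (THE p. counts_peaks S p))"

end

theory Submission
  imports Defs "HOL-Combinatorics.Multiset_Permutations" "HOL-Library.Infinite_Set"
begin

text \<open>
  Let \<open>m = Max S\<close>, \<open>k = m - 1\<close> and \<open>T = S - {m}\<close>, where we may assume \<open>k \<notin> S\<close>. Cut a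
  permutation of \<open>{1..n}\<close> after position \<open>k\<close>: the first part has peak set \<open>T\<close> and the second
  part has no peaks iff the whole permutation has peak set \<open>T\<close>, \<open>T \<union> {k}\<close> or \<open>S\<close>. Counting both
  sides gives the recursion of Billey, Burdzy and Sagan,
  \<open>p\<^sub>S(x) = p\<^sub>T(k) (x choose k) - 2 p\<^sub>T(x) - p\<^bsub>T \<union> {k}\<^esub>(x)\<close>.
  At \<open>x \<in> T\<close> the binomial coefficient vanishes because \<open>x < k\<close>, and the other two terms vanish by
  induction. At \<open>x = m\<close> the polynomial vanishes because a permutation of \<open>{1..m}\<close> has no peak
  at its last position.
\<close>

section \<open>Peak sets of words over a linear order\<close>

text \<open>Positions are counted from 1, as in \<open>peaks\<close>, so the \<open>i\<close>-th
  entry is \<open>xs ! (i - 1)\<close>. Entries may come from any linear order, since cutting a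
  permutation leaves blocks whose values are not an initial segment.\<close>

definition list_peaks :: "'a::linorder list \<Rightarrow> nat set" where
  "list_peaks xs = {i. 1 < i \<and> i < length xs \<and> xs ! (i - 2) < xs ! (i - 1) \<and> xs ! (i - 1) > xs ! i}"

definition lists_with_peaks :: "nat set \<Rightarrow> 'a::linorder set \<Rightarrow> 'a list set" where
  "lists_with_peaks S A = {xs \<in> permutations_of_set A. list_peaks xs = S}"

lemma finite_lists_with_peaks [simp]: "finite (lists_with_peaks S A)"
  by (simp add: lists_with_peaks_def)

lemma lists_with_peaks_length: "xs \<in> lists_with_peaks S A \<Longrightarrow> length xs = card A"
  by (simp add: lists_with_peaks_def length_finite_permutations_of_set)

lemma list_peaks_map:
  assumes "strict_mono_on (set xs) f"
  shows "list_peaks (map f xs) = list_peaks xs"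
  unfolding list_peaks_def using strict_mono_on_less[OF assms] by auto

text \<open>A peak depends on three neighbouring entries. The bounds here and in
  \<open>list_peaks_append_right\<close> keep these inside one block, so only positions
  \<open>length xs\<close> and \<open>length xs + 1\<close> see both sides of the cut.\<close>

lemma list_peaks_append_left:
  "i < length xs \<Longrightarrow> i \<in> list_peaks (xs @ ys) \<longleftrightarrow> i \<in> list_peaks xs"
  by (auto simp: list_peaks_def nth_append)

lemma list_peaks_append_right:
  "1 < i \<Longrightarrow> length xs + i \<in> list_peaks (xs @ ys) \<longleftrightarrow> i \<in> list_peaks ys"
  by (auto simp: list_peaks_def nth_append)

lemma list_peaks_not_consecutive: "i \<in> list_peaks xs \<Longrightarrow> Suc i \<notin> list_peaks xs"
  by (auto simp: list_peaks_def)

lemma list_peaks_bounds: "i \<in> list_peaks xs \<Longrightarrow> 1 < i \<and> i < length xs"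
  by (auto simp: list_peaks_def)

section \<open>Permutations as words; independence of the alphabet\<close>

lemma card_perms_with_peaks:
  "card (perms_with_peaks S n) = card (lists_with_peaks S {1..n})"
proof (rule bij_betw_same_card[of "\<lambda>\<pi>. map \<pi> [1..<Suc n]"], rule bij_betw_imageI)
  show "inj_on (\<lambda>\<pi>. map \<pi> [1..<Suc n]) (perms_with_peaks S n)"
  proof (rule inj_onI)
    fix \<pi> \<sigma>
    assume "\<pi> \<in> perms_with_peaks S n" "\<sigma> \<in> perms_with_peaks S n"
      and eq: "map \<pi> [1..<Suc n] = map \<sigma> [1..<Suc n]"
    then have perm: "\<pi> permutes {1..n}" "\<sigma> permutes {1..n}"
      by (auto simp: perms_with_peaks_def)
    have "\<pi> i = \<sigma> i" if "i \<in> {1..n}" for i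
      using eq that unfolding map_eq_conv set_upt atLeastLessThanSuc_atLeastAtMost by blast
    then show "\<pi> = \<sigma>"
      using perm permutes_not_in by (metis ext)
  qed
next
  have peaks: "list_peaks (map \<pi> [1..<Suc n]) = peaks n \<pi>" for \<pi> :: "nat \<Rightarrow> nat"
  proof -
    have "map \<pi> [1..<Suc n] ! j = \<pi> (Suc j)" if "j < n" for j
      using that by (simp del: upt_Suc)
    then show ?thesis
      unfolding list_peaks_def peaks_def by (auto simp del: upt_Suc simp: Suc_diff_Suc numeral_2_eq_2)
  qed
  show "(\<lambda>\<pi>. map \<pi> [1..<Suc n]) ` perms_with_peaks S n = lists_with_peaks S {1..n}"
  proof (intro equalityI subsetI)
    fix xs assume "xs \<in> (\<lambda>\<pi>. map \<pi> [1..<Suc n]) ` perms_with_peaks S n"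
    then obtain \<pi> where xs: "xs = map \<pi> [1..<Suc n]" and perm: "\<pi> permutes {1..n}"
      and S: "peaks n \<pi> = S"
      by (auto simp: perms_with_peaks_def)
    have "set xs = {1..n}"
      using permutes_image[OF perm] by (simp add: xs atLeastLessThanSuc_atLeastAtMost del: upt_Suc)
    moreover have "distinct xs"
      using permutes_inj_on[OF perm] by (simp add: xs distinct_map del: upt_Suc)
    ultimately show "xs \<in> lists_with_peaks S {1..n}"
      using S peaks[of \<pi>] by (auto simp: lists_with_peaks_def permutations_of_set_def xs simp del: upt_Suc)
  next
    fix xs assume "xs \<in> lists_with_peaks S {1..n}"
    then have set: "set xs = {1..n}" and dist: "distinct xs" and S: "list_peaks xs = S"
      by (auto simp: lists_with_peaks_def permutations_of_set_def)
    have len: "length xs = n"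
      using distinct_card[OF dist] set by simp
    \<comment> \<open>Values outside \<open>{1..n}\<close> are fixed because \<open>permutes\<close>
      demands it.\<close>
    define \<pi> where "\<pi> i = (if i \<in> {1..n} then xs ! (i - 1) else i)" for i
    have xs: "xs = map \<pi> [1..<Suc n]"
      by (rule nth_equalityI) (auto simp: len \<pi>_def simp del: upt_Suc)
    have "\<pi> ` {1..n} = {1..n}"
      using set by (subst (asm) xs) (simp add: atLeastLessThanSuc_atLeastAtMost del: upt_Suc)
    moreover from this have "inj_on \<pi> {1..n}"
      by (intro eq_card_imp_inj_on) auto
    ultimately have "\<pi> permutes {1..n}"
      by (intro bij_imp_permutes bij_betw_imageI) (auto simp: \<pi>_def)
    then have "\<pi> \<in> perms_with_peaks S n"
      using S peaks[of \<pi>] xs by (simp add: perms_with_peaks_def)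
    then show "xs \<in> (\<lambda>\<pi>. map \<pi> [1..<Suc n]) ` perms_with_peaks S n"
      using xs by blast
  qed
qed

lemma lists_with_peaks_image:
  assumes "strict_mono_on A f"
  shows "lists_with_peaks S (f ` A) = map f ` lists_with_peaks S A"
proof -
  have "inj_on f A"
    using assms by (rule strict_mono_on_imp_inj_on)
  then have "permutations_of_set (f ` A) = map f ` permutations_of_set A"
    by (rule permutations_of_set_image_inj)
  moreover have "list_peaks (map f xs) = list_peaks xs" if "xs \<in> permutations_of_set A" for xs
    using assms that by (intro list_peaks_map) (simp add: permutations_of_set_def)
  ultimately show ?thesis
    by (auto simp: lists_with_peaks_def)
qed

text \<open>Relabelling along the increasing enumeration of \<open>A\<close> keeps all comparisons,
  hence all peaks.\<close>

lemma card_lists_with_peaks_initial_segment: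
  fixes A :: "'a::wellorder set"
  assumes "finite A"
  shows "card (lists_with_peaks S A) = card (lists_with_peaks S {..<card A})"
proof -
  obtain f where bij: "bij_betw f {..<card A} A" and mono: "strict_mono_on {..<card A} f"
    using ex_bij_betw_strict_mono_card[OF assms] by blast
  have "inj_on (map f) (lists_with_peaks S {..<card A})"
    using bij by (intro inj_onI)
      (auto simp: lists_with_peaks_def permutations_of_set_def bij_betw_def dest: map_inj_on)
  moreover have "lists_with_peaks S A = map f ` lists_with_peaks S {..<card A}"
    using lists_with_peaks_image[OF mono] bij by (simp add: bij_betw_def)
  ultimately show ?thesis
    by (simp add: card_image)
qed

text \<open>Both \<open>A\<close> and \<open>{1..card A}\<close> are compared with
  \<open>{..<card A}\<close>. This lets each block of a cut permutation be counted by its size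
  alone.\<close>

lemma card_lists_with_peaks:
  fixes A :: "'a::wellorder set"
  assumes "finite A"
  shows "card (lists_with_peaks S A) = card (perms_with_peaks S (card A))"
  using card_lists_with_peaks_initial_segment[OF assms]
    card_lists_with_peaks_initial_segment[of "{1..card A}"]
  by (simp add: card_perms_with_peaks)

section \<open>Words without peaks\<close>

text \<open>A maximal first entry is not below its neighbour, so position 2 is no peak; all other
  peaks merely shift by one.\<close>

lemma list_peaks_Cons_max:
  assumes "\<And>y. y \<in> set ys \<Longrightarrow> y \<le> x"
  shows "list_peaks (x # ys) = {} \<longleftrightarrow> list_peaks ys = {}"
proof -
  have "i \<in> list_peaks (x # ys) \<longleftrightarrow> i - 1 \<in> list_peaks ys" if "i \<noteq> 2" for i
    using that by (auto simp: list_peaks_def nth_Cons' eval_nat_numeral)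
  moreover have "2 \<notin> list_peaks (x # ys)"
    using assms[of "ys ! 0"] by (cases ys) (auto simp: list_peaks_def)
  moreover have "1 \<notin> list_peaks ys"
    by (simp add: list_peaks_def)
  ultimately show ?thesis
    by (metis (no_types, lifting) all_not_in_conv diff_add_inverse2 one_add_one)
qed

text \<open>The only old position with a new neighbour is \<open>length ys\<close>, and it does not
  exceed the appended \<open>x\<close>; the last position is never a peak.\<close>

lemma list_peaks_snoc_max:
  assumes "\<And>y. y \<in> set ys \<Longrightarrow> y \<le> x"
  shows "list_peaks (ys @ [x]) = list_peaks ys"
proof (intro set_eqI)
  fix i
  show "i \<in> list_peaks (ys @ [x]) \<longleftrightarrow> i \<in> list_peaks ys"
  proof (cases "i = length ys")
    case True
    then show ?thesis
      using assms[OF nth_mem, of "i - 1"] by (auto simp: list_peaks_def nth_append)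
  qed (auto simp: list_peaks_def nth_append)
qed

text \<open>A maximum in the interior would be a peak, so it stands at one of the two ends.\<close>

lemma lists_without_peaks_rec:
  assumes "finite A" "x \<notin> A" "\<And>y. y \<in> A \<Longrightarrow> y \<le> x"
  shows "lists_with_peaks {} (insert x A) =
    Cons x ` lists_with_peaks {} A \<union> (\<lambda>ys. ys @ [x]) ` lists_with_peaks {} A"
proof (intro equalityI subsetI)
  fix xs assume "xs \<in> lists_with_peaks {} (insert x A)"
  then have set: "set xs = insert x A" and dist: "distinct xs" and no_peak: "list_peaks xs = {}"
    by (auto simp: lists_with_peaks_def permutations_of_set_def)
  obtain us vs where xs: "xs = us @ x # vs"
    using set by (metis insertI1 split_list)
  have A: "A = set us \<union> set vs"
    using set dist assms(2) by (auto simp: xs)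
  have "us = [] \<or> vs = []"
  proof (rule ccontr)
    assume "\<not> ?thesis"
    then obtain us' a b vs' where [simp]: "us = us' @ [a]" "vs = b # vs'"
      by (metis neq_Nil_conv rev_exhaust)
    have "a < x" "b < x"
      using assms(2,3) A by (auto simp: order_less_le)
    \<comment> \<open>This is the position of \<open>x\<close>, counted from 1.\<close>
    then have "length us + 1 \<in> list_peaks xs"
      by (auto simp: list_peaks_def xs nth_append)
    with no_peak show False by simp
  qed
  then show "xs \<in> Cons x ` lists_with_peaks {} A \<union> (\<lambda>ys. ys @ [x]) ` lists_with_peaks {} A"
  proof
    assume "us = []"
    then have "xs = x # vs" "vs \<in> lists_with_peaks {} A"
      using dist A no_peak assms(3) list_peaks_Cons_max[of vs x]
      by (auto simp: xs lists_with_peaks_def permutations_of_set_def)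
    then show ?thesis by blast
  next
    assume "vs = []"
    then have "xs = us @ [x]" "us \<in> lists_with_peaks {} A"
      using dist A no_peak assms(3) list_peaks_snoc_max[of us x]
      by (auto simp: xs lists_with_peaks_def permutations_of_set_def)
    then show ?thesis by blast
  qed
next
  fix xs assume "xs \<in> Cons x ` lists_with_peaks {} A \<union> (\<lambda>ys. ys @ [x]) ` lists_with_peaks {} A"
  then show "xs \<in> lists_with_peaks {} (insert x A)"
    using assms(2,3) list_peaks_Cons_max[of _ x] list_peaks_snoc_max[of _ x]
    by (auto simp: lists_with_peaks_def permutations_of_set_def)
qed

text \<open>Each new maximum can go to either end, which doubles the count. The factor 2 on the left
  avoids the exponent \<open>card A - 1\<close>.\<close>

lemma card_lists_without_peaks:
  fixes A :: "'a::linorder set"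
  assumes "finite A" "A \<noteq> {}"
  shows "2 * card (lists_with_peaks {} A) = 2 ^ card A"
  using assms
proof (induction A rule: finite_linorder_max_induct)
  case empty
  then show ?case by simp
next
  case (insert x A)
  show ?case
  proof (cases "A = {}")
    case True
    have "lists_with_peaks {} {x} = {[x]}"
      by (auto simp: lists_with_peaks_def list_peaks_def)
    then show ?thesis
      using True by simp
  next
    case False
    have x: "x \<notin> A"
      using insert.hyps by blast
    let ?L = "lists_with_peaks {} A"
    \<comment> \<open>The two extensions differ because \<open>A\<close> is nonempty; over an empty
      \<open>A\<close> both would be \<open>[x]\<close>.\<close>
    have "x # ys \<noteq> zs @ [x]" if "ys \<in> ?L" "zs \<in> ?L" for ys zs
    proof
      assume "x # ys = zs @ [x]"
      moreover have "set ys = A" "set zs = A"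
        using that by (auto simp: lists_with_peaks_def permutations_of_set_def)
      ultimately show False
        using x False by (cases zs) auto
    qed
    then have "Cons x ` ?L \<inter> (\<lambda>ys. ys @ [x]) ` ?L = {}"
      by auto
    moreover have "lists_with_peaks {} (insert x A) = Cons x ` ?L \<union> (\<lambda>ys. ys @ [x]) ` ?L"
      using insert.hyps x by (intro lists_without_peaks_rec) auto
    ultimately have "card (lists_with_peaks {} (insert x A)) = 2 * card ?L"
      by (simp add: card_Un_disjoint card_image inj_on_def)
    then show ?thesis
      using insert x False by simp
  qed
qed

lemma card_perms_without_peaks: "n > 0 \<Longrightarrow> 2 * card (perms_with_peaks {} n) = 2 ^ n"
  by (simp add: card_perms_with_peaks card_lists_without_peaks)

section \<open>Cutting a permutation and the resulting recursion\<close>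

text \<open>The blocks determine all peaks except at the straddling positions \<open>k\<close> and
  \<open>Suc k\<close>, and these, being adjacent, are never both peaks. This leaves exactly three
  possible peak sets.\<close>

lemma list_peaks_append_eq_iff:
  assumes "length xs = k" "T \<subseteq> {..<k}"
  shows "list_peaks (xs @ ys) \<in> {T, insert k T, insert (Suc k) T} \<longleftrightarrow>
    list_peaks xs = T \<and> list_peaks ys = {}"
  (is "?P \<in> _ \<longleftrightarrow> _")
proof
  assume P: "?P \<in> {T, insert k T, insert (Suc k) T}"
  have "i \<in> list_peaks xs \<longleftrightarrow> i \<in> T" for i
  proof (cases "i < k")
    case True
    then show ?thesis
      using P assms list_peaks_append_left[of i xs ys] by auto
  next
    case False
    then show ?thesis
      using assms list_peaks_bounds[of i xs] by auto
  qed
  moreover have "i \<notin> list_peaks ys" for i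
  proof
    assume i: "i \<in> list_peaks ys"
    then have "1 < i"
      using list_peaks_bounds by blast
    then have "k + i \<in> ?P"
      using i assms list_peaks_append_right by blast
    \<comment> \<open>Since \<open>i\<close> exceeds 1, \<open>k + i\<close> lies beyond
      \<open>Suc k\<close> and so in none of the three sets.\<close>
    then show False
      using P assms(2) \<open>1 < i\<close> by auto
  qed
  ultimately show "list_peaks xs = T \<and> list_peaks ys = {}"
    by blast
next
  assume peaks: "list_peaks xs = T \<and> list_peaks ys = {}"
  have "i \<in> ?P \<longleftrightarrow> i \<in> T" if "i \<noteq> k" "i \<noteq> Suc k" for i
  proof (cases "i < k")
    case True
    then show ?thesis
      using peaks assms list_peaks_append_left[of i xs ys] by auto
  next
    case False
    then have "i = k + (i - k)" "1 < i - k"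
      using that by auto
    then show ?thesis
      using peaks assms list_peaks_append_right[of "i - k" xs ys] by auto
  qed
  moreover have "k \<notin> T" "Suc k \<notin> T"
    using assms(2) by auto
  \<comment> \<open>This excludes the fourth candidate, \<open>T\<close> together with both
    \<open>k\<close> and \<open>Suc k\<close>.\<close>
  moreover have "k \<notin> ?P \<or> Suc k \<notin> ?P"
    using list_peaks_not_consecutive by blast
  ultimately have "?P = T \<or> ?P = insert k T \<or> ?P = insert (Suc k) T"
    by (cases "k \<in> ?P"; cases "Suc k \<in> ?P") (auto, metis+)
  then show "?P \<in> {T, insert k T, insert (Suc k) T}"
    by simp
qed

text \<open>The words are sorted by the set \<open>B\<close> of values occupying the first
  \<open>k\<close> positions.\<close>

lemma lists_with_peaks_split:
  assumes A: "finite A" and k: "k \<le> card A" and T: "T \<subseteq> {..<k}"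
  shows "lists_with_peaks T A \<union> lists_with_peaks (insert k T) A \<union> lists_with_peaks (insert (Suc k) T) A
    = (\<Union>B\<in>{B. B \<subseteq> A \<and> card B = k}.
        (\<lambda>(xs, ys). xs @ ys) ` (lists_with_peaks T B \<times> lists_with_peaks {} (A - B)))"
    (is "?L = ?R")
proof (intro equalityI subsetI)
  fix zs assume "zs \<in> ?L"
  then have set: "set zs = A" and dist: "distinct zs"
    and peaks: "list_peaks zs \<in> {T, insert k T, insert (Suc k) T}"
    by (auto simp: lists_with_peaks_def permutations_of_set_def)
  define xs ys where "xs = take k zs" and "ys = drop k zs"
  have zs: "zs = xs @ ys"
    by (simp add: xs_def ys_def)
  have len: "length xs = k"
    using k distinct_card[OF dist] set by (simp add: xs_def)
  have "list_peaks xs = T" "list_peaks ys = {}"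
    using peaks list_peaks_append_eq_iff[OF len T] by (auto simp: zs)
  moreover have "distinct xs" "distinct ys" "set ys = A - set xs" "set xs \<subseteq> A"
    using dist set by (auto simp: zs)
  moreover have "card (set xs) = k"
    using len distinct_card[of xs] calculation by simp
  ultimately show "zs \<in> ?R"
    by (auto simp: lists_with_peaks_def permutations_of_set_def zs)
next
  fix zs assume "zs \<in> ?R"
  then obtain B xs ys where B: "B \<subseteq> A" "card B = k" and zs: "zs = xs @ ys"
    and mem: "xs \<in> lists_with_peaks T B" "ys \<in> lists_with_peaks {} (A - B)"
    by auto
  have "length xs = k"
    using lists_with_peaks_length mem(1) B by blast
  then have "list_peaks zs \<in> {T, insert k T, insert (Suc k) T}"
    using list_peaks_append_eq_iff[OF _ T, of xs ys] mem by (auto simp: zs lists_with_peaks_def)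
  moreover have "zs \<in> permutations_of_set A"
    using mem B by (auto simp: zs lists_with_peaks_def permutations_of_set_def)
  ultimately show "zs \<in> ?L"
    by (auto simp: lists_with_peaks_def)
qed

text \<open>There are \<open>n choose k\<close> choices of \<open>B\<close> in the split, and the
  number of words for each depends only on the block sizes \<open>k\<close> and
  \<open>n - k\<close>.\<close>

lemma card_perms_with_peaks_rec:
  assumes k: "k \<le> n" and T: "T \<subseteq> {..<k}"
  shows "card (perms_with_peaks T n) + card (perms_with_peaks (insert k T) n)
      + card (perms_with_peaks (insert (Suc k) T) n)
    = (n choose k) * card (perms_with_peaks T k) * card (perms_with_peaks {} (n - k))"
proof -
  let ?A = "{1..n}"
  let ?I = "{B. B \<subseteq> ?A \<and> card B = k}"
  let ?L = "\<lambda>S. lists_with_peaks S ?A"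
  let ?F = "\<lambda>B. (\<lambda>(xs, ys). xs @ ys) ` (lists_with_peaks T B \<times> lists_with_peaks {} (?A - B))"
  have ne: "T \<noteq> insert k T" "T \<noteq> insert (Suc k) T" "insert k T \<noteq> insert (Suc k) T"
    using T by auto
  have "card (?L T) + card (?L (insert k T)) + card (?L (insert (Suc k) T))
      = card (?L T \<union> ?L (insert k T) \<union> ?L (insert (Suc k) T))"
    using ne by (subst card_Un_disjoint; (subst card_Un_disjoint)?) (auto simp: lists_with_peaks_def)
  also have "\<dots> = card (\<Union>B\<in>?I. ?F B)"
    using lists_with_peaks_split[of ?A k T] k T by simp
  also have "\<dots> = (\<Sum>B\<in>?I. card (?F B))"
  proof (rule card_UN_disjoint)
    show "\<forall>B\<in>?I. \<forall>C\<in>?I. B \<noteq> C \<longrightarrow> ?F B \<inter> ?F C = {}"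
    proof (intro ballI impI)
      fix B C assume BC: "B \<in> ?I" "C \<in> ?I" "B \<noteq> C"
      \<comment> \<open>\<open>B\<close> can be read off the word from its first \<open>k\<close>
        entries, so different choices give disjoint families.\<close>
      have prefix: "set (take k zs) = D" if "D \<in> ?I" "zs \<in> ?F D" for D zs
        using that lists_with_peaks_length[of _ T D]
        by (auto simp: lists_with_peaks_def permutations_of_set_def)
      show "?F B \<inter> ?F C = {}"
      proof (rule equals0I)
        fix zs assume "zs \<in> ?F B \<inter> ?F C"
        then have "set (take k zs) = B" "set (take k zs) = C"
          using prefix[OF BC(1)] prefix[OF BC(2)] by (meson IntD1 IntD2)+
        with BC(3) show False
          by simp
      qed
    qed
  qed auto
  also have "\<dots> = (\<Sum>B\<in>?I. card (perms_with_peaks T k) * card (perms_with_peaks {} (n - k)))"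
  proof (rule sum.cong)
    fix B assume B: "B \<in> ?I"
    then have fin: "finite B"
      using finite_subset by blast
    \<comment> \<open>All first blocks have length \<open>card B\<close>, so the cut point is
      determined.\<close>
    have "inj_on (\<lambda>(xs, ys). xs @ ys) (lists_with_peaks T B \<times> lists_with_peaks {} (?A - B))"
      using lists_with_peaks_length[of _ T B] by (auto simp: inj_on_def)
    then have "card (?F B) = card (lists_with_peaks T B) * card (lists_with_peaks {} (?A - B))"
      by (simp add: card_image card_cartesian_product)
    also have "\<dots> = card (perms_with_peaks T k) * card (perms_with_peaks {} (n - k))"
      using B fin by (simp add: card_lists_with_peaks card_Diff_subset)
    finally show "card (?F B) = card (perms_with_peaks T k) * card (perms_with_peaks {} (n - k))" .
  qed simp
  also have "\<dots> = (n choose k) * card (perms_with_peaks T k) * card (perms_with_peaks {} (n - k))"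
    by (simp add: n_subsets)
  finally show ?thesis
    by (simp add: card_perms_with_peaks)
qed

section \<open>The counting polynomial and its zeros\<close>

definition binomial_poly :: "nat \<Rightarrow> 'a::field_char_0 poly" where
  "binomial_poly k = smult (1 / fact k) (\<Prod>i<k. [:- of_nat i, 1:])"

lemma poly_binomial_poly: "poly (binomial_poly k) (of_nat n) = of_nat (n choose k)"
  by (simp add: binomial_poly_def poly_prod binomial_gbinomial gbinomial_prod_rev atLeast0LessThan)

lemma peaks_not_consecutive: "i \<in> peaks n \<pi> \<Longrightarrow> Suc i \<notin> peaks n \<pi>"
  by (auto simp: peaks_def)

text \<open>Induction on a bound for \<open>S\<close> makes both \<open>T\<close> and
  \<open>insert k T\<close> accessible. Inadmissible sets are included because
  \<open>insert k T\<close> may be one. Powers of 2 are multiplied out to avoid truncated exponents;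
  \<open>n > 0\<close> is needed since for \<open>S = {}\<close> the formula with the polynomial 1
  fails at 0.\<close>

lemma exists_peak_poly_vanishing:
  fixes S :: "nat set"
  assumes "S \<subseteq> {1..m}"
  shows "\<exists>q :: rat poly.
    (\<forall>n>0. (\<forall>i\<in>S. i \<le> n) \<longrightarrow>
      of_nat (card (perms_with_peaks S n)) * 2 ^ Suc (card S) = poly q (of_nat n) * 2 ^ n) \<and>
    (\<forall>i\<in>S. poly q (of_nat i) = 0)"
  using assms
proof (induction m arbitrary: S)
  case 0
  then have "S = {}" by simp
  moreover have "of_nat (card (perms_with_peaks {} n)) * 2 = (2 ^ n :: rat)" if "n > 0" for n
    using arg_cong[OF card_perms_without_peaks[OF that], of "of_nat :: nat \<Rightarrow> rat"] by simp
  ultimately show ?case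
    by (intro exI[of _ 1]) simp
next
  case (Suc k)
  have empty: ?case if "\<And>n. perms_with_peaks S n = {}"
    using that by (intro exI[of _ 0]) simp
  consider "Suc k \<notin> S" | "Suc k \<in> S" "k \<in> S \<or> k = 0" | "Suc k \<in> S" "k \<notin> S" "k > 0"
    by blast
  then show ?case
  proof cases
    case 1
    then have "S \<subseteq> {1..k}"
      using Suc.prems by (auto simp: le_Suc_eq)
    then show ?thesis by (rule Suc.IH)
  next
    case 2
    \<comment> \<open>Here \<open>S\<close> contains two consecutive positions or the position 1, so
      the zero polynomial serves.\<close>
    then have "peaks n \<pi> \<noteq> S" for n \<pi>
      using peaks_not_consecutive[of k n \<pi>] by (auto simp: peaks_def)
    then show ?thesis
      by (intro empty) (auto simp: perms_with_peaks_def)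
  next
    case 3
    define T where "T = S - {Suc k}"
    have S: "S = insert (Suc k) T" and "Suc k \<notin> T"
      using 3 by (auto simp: T_def)
    have T: "T \<subseteq> {1..<k}"
    proof
      fix i assume "i \<in> T"
      then have "i \<in> S" "i \<noteq> Suc k" "i \<noteq> k"
        using 3 by (auto simp: T_def)
      then show "i \<in> {1..<k}"
        using Suc.prems by auto
    qed
    then have "T \<subseteq> {..<k}"
      by auto
    have fin: "finite T"
      using T finite_subset by blast
    have "k \<notin> T"
      using T by auto
    with fin \<open>Suc k \<notin> T\<close> have card: "card S = Suc (card T)" "card (insert k T) = Suc (card T)"
      by (auto simp: S)
    obtain q1 :: "rat poly" where
      q1: "\<And>n. n > 0 \<Longrightarrow> \<forall>i\<in>T. i \<le> n \<Longrightarrow>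
        of_nat (card (perms_with_peaks T n)) * 2 ^ Suc (card T) = poly q1 (of_nat n) * 2 ^ n"
      and q1_zero: "\<And>i. i \<in> T \<Longrightarrow> poly q1 (of_nat i) = 0"
      using Suc.IH[of T] T by fastforce
    obtain q2 :: "rat poly" where
      q2: "\<And>n. n > 0 \<Longrightarrow> \<forall>i\<in>insert k T. i \<le> n \<Longrightarrow>
        of_nat (card (perms_with_peaks (insert k T) n)) * 2 ^ Suc (Suc (card T))
          = poly q2 (of_nat n) * 2 ^ n"
      and q2_zero: "\<And>i. i \<in> insert k T \<Longrightarrow> poly q2 (of_nat i) = 0"
      using Suc.IH[of "insert k T"] T \<open>k > 0\<close> unfolding card by fastforce
    \<comment> \<open>This is the recursion multiplied by \<open>2 ^ Suc (Suc (card T))\<close> and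
      divided by \<open>2 ^ n\<close>. The coefficient 2 arises because \<open>T\<close> has one
      element fewer than \<open>S\<close>.\<close>
    define q where "q = smult (poly q1 (of_nat k)) (binomial_poly k) - smult 2 q1 - q2"
    have count: "of_nat (card (perms_with_peaks S n)) * 2 ^ Suc (card S) = poly q (of_nat n) * 2 ^ n"
      if n: "Suc k \<le> n" for n
    proof -
      let ?c = "\<lambda>S n. of_nat (card (perms_with_peaks S n)) :: rat"
      have rec: "?c T n + ?c (insert k T) n + ?c S n = of_nat (n choose k) * ?c T k * ?c {} (n - k)"
        using arg_cong[OF card_perms_with_peaks_rec[of k n T], of "of_nat :: nat \<Rightarrow> rat"]
          \<open>T \<subseteq> {..<k}\<close> n
        by (simp add: S)
      \<comment> \<open>All of \<open>T\<close> lies below \<open>k\<close>, so the formula for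
        \<open>T\<close> already holds at \<open>k\<close>; this turns the constant factor of the
        recursion into a value of \<open>q1\<close>.\<close>
      have T_k: "?c T k * 2 ^ Suc (card T) = poly q1 (of_nat k) * 2 ^ k"
        using T \<open>k > 0\<close> by (intro q1) auto
      have T_n: "?c T n * 2 ^ Suc (card T) = poly q1 (of_nat n) * 2 ^ n"
        using T n by (intro q1) auto
      have T'_n: "?c (insert k T) n * 2 ^ Suc (Suc (card T)) = poly q2 (of_nat n) * 2 ^ n"
        using T n by (intro q2) auto
      have none: "?c {} (n - k) * 2 = 2 ^ (n - k)"
        using arg_cong[OF card_perms_without_peaks[of "n - k"], of "of_nat :: nat \<Rightarrow> rat"] n by simp
      have "?c S n * 2 ^ Suc (card S)
          = of_nat (n choose k) * (?c T k * 2 ^ Suc (card T)) * (?c {} (n - k) * 2)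
            - 2 * (?c T n * 2 ^ Suc (card T)) - ?c (insert k T) n * 2 ^ Suc (Suc (card T))"
        unfolding eq_diff_eq card using arg_cong[OF rec, of "\<lambda>x. x * 2 ^ Suc (Suc (card T))"]
        by (simp add: algebra_simps)
      also have "\<dots> = of_nat (n choose k) * poly q1 (of_nat k) * (2 ^ k * 2 ^ (n - k))
            - 2 * poly q1 (of_nat n) * 2 ^ n - poly q2 (of_nat n) * 2 ^ n"
        unfolding T_k T_n T'_n none by simp
      also have "2 ^ k * 2 ^ (n - k) = (2 ^ n :: rat)"
        using n by (simp flip: power_add)
      finally show ?thesis
        by (simp add: q_def poly_binomial_poly algebra_simps)
    qed
    moreover have "poly q (of_nat i) = 0" if "i \<in> S" for i
    proof (cases "i = Suc k")
      case True
      have "perms_with_peaks S (Suc k) = {}"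
        using 3 by (auto simp: perms_with_peaks_def peaks_def)
      then show ?thesis
        \<comment> \<open>At \<open>n = Suc k\<close> the counting formula reads
          \<open>0 = poly q (of_nat n) * 2 ^ n\<close>.\<close>
        using count[of "Suc k"] True by simp
    next
      case False
      then have "i \<in> T"
        using that by (simp add: S)
      then show ?thesis
        \<comment> \<open>The binomial term vanishes since \<open>i < k\<close>.\<close>
        using T q1_zero[of i] q2_zero[of i] by (auto simp: q_def poly_binomial_poly)
    qed
    ultimately show ?thesis
      using 3(1) by (intro exI[of _ q]) auto
  qed
qed

section \<open>Transfer to the peak polynomial\<close>

theorem theorem1p4:
  fixes S :: "nat set"
  assumes "finite S"
    and "\<forall>i\<in>S. 0 < i"
  shows "\<forall>i\<in>S. poly (peak_poly S) (of_nat i) = 0"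
proof (cases "admissible S \<and> S \<noteq> {}")
  case False
  then show ?thesis
    by (auto simp: peak_poly_def)
next
  case True
  then have "S \<noteq> {}" by simp
  have "1 \<notin> S"
    using True by (auto simp: admissible_def perms_with_peaks_def peaks_def)
  have sub: "S \<subseteq> {2..Max S}"
  proof
    fix i assume i: "i \<in> S"
    then have "0 < i" "i \<noteq> 1" "i \<le> Max S"
      using assms \<open>1 \<notin> S\<close> by auto
    then show "i \<in> {2..Max S}"
      by simp
  qed
  \<comment> \<open>The set \<open>{2..Max S}\<close> has \<open>Max S - 1\<close> elements. The
    bound keeps \<open>n - card S - 1\<close> from truncating when the powers of 2 are
    cancelled.\<close>
  have card: "Suc (card S) \<le> Max S"
    using card_mono[OF _ sub] sub Max_in[OF assms(1) \<open>S \<noteq> {}\<close>] by auto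
  have "S \<subseteq> {1..Max S}"
    using sub by auto
  from exists_peak_poly_vanishing[OF this] obtain q :: "rat poly" where
    q: "\<And>n. n > 0 \<Longrightarrow> \<forall>i\<in>S. i \<le> n \<Longrightarrow>
      of_nat (card (perms_with_peaks S n)) * 2 ^ Suc (card S) = poly q (of_nat n) * 2 ^ n"
    and zero: "\<And>i. i \<in> S \<Longrightarrow> poly q (of_nat i) = 0"
    by blast
  have "counts_peaks S q"
    unfolding counts_peaks_def
  proof (intro allI impI)
    fix n assume n: "Max S \<le> n"
    then have "of_nat (card (perms_with_peaks S n)) * 2 ^ Suc (card S) = poly q (of_nat n) * 2 ^ n"
      using assms(1) card by (intro q) (auto intro: order_trans[OF Max_ge])
    also have "2 ^ n = (2 ^ (n - card S - 1) * 2 ^ Suc (card S) :: rat)"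
      using n card unfolding power_add[symmetric] by (intro arg_cong[of _ _ "\<lambda>k. 2 ^ k"]) simp
    finally show "of_nat (card (perms_with_peaks S n)) = poly q (of_nat n) * 2 ^ (n - card S - 1)"
      by simp
  qed
  \<comment> \<open>Uniqueness of the counting polynomial identifies the one chosen by
    \<open>peak_poly\<close> with \<open>q\<close>, whose zeros are known.\<close>
  then have "(THE p. counts_peaks S p) = q"
    using counts_peaks_unique by blast
  then show ?thesis
    using True zero by (simp add: peak_poly_def)
qed

end
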